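(* Let \(L\) be a set of \(n\) infinite binary strings whose bits are all chosen independently and uniformly at random, and let \(p_0(L)\) be the nonvoid external path length of the minimal trie on \(L\). Let \(R_0(t)=-\ln\Pr[p_0(L)\ge \mathbb{E}[p_0(L)]+t]\). Then there exists a constant \(C>0\) such that for every constant \(c>C\), \(R_0(cn)=\Theta(n)\) as \(n\to\infty\).
   Context: For a set \(L=\{\alpha_0,\dots,\alpha_{n-1}\}\) of \(n\) distinct infinite binary strings (distinct with probability 1 under the random model), let \(\varphi_0(L)=\{\beta_0,\dots,\beta_{n-1}\}\) be the set of finite strings such that each \(\beta_i\) is a prefix of \(\alpha_i\), the set \(\{\beta_i\}\) is prefix-free (no \(\beta_i\) is a prefix of \(\beta_j\) for \(i\ne j\)), and \(\sum_i|\beta_i|\) is minimum subject to these conditions. The nonvoid external path length is \(p_0(L)=\sum_{\beta\in\varphi_0(L)}|\beta|\), i.e. the sum of the leaf depths of the minimal trie on \(L\). \(\ln\) is the natural logarithm. *)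

theory Defs
  imports "HOL-Probability.Probability" "HOL-Library.Sublist" "HOL-Library.Landau_Symbols"
begin

definition prefix_of_string :: "bool list \<Rightarrow> bool stream \<Rightarrow> bool" where
  "prefix_of_string \<beta> \<alpha> \<longleftrightarrow> stake (length \<beta>) \<alpha> = \<beta>"

text \<open>A labelling \<open>b\<close> assigns to each string \<open>\<alpha>\<close> of \<open>L\<close> its finite string \<open>\<beta>\<close>.\<close>

definition prefix_free_labelling :: "bool stream set \<Rightarrow> (bool stream \<Rightarrow> bool list) \<Rightarrow> bool" where
  "prefix_free_labelling L b \<longleftrightarrow>
     (\<forall>\<alpha>\<in>L. prefix_of_string (b \<alpha>) \<alpha>) \<and>
     (\<forall>\<alpha>\<in>L. \<forall>\<alpha>'\<in>L. \<alpha> \<noteq> \<alpha>' \<longrightarrow> \<not> prefix (b \<alpha>) (b \<alpha>'))"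

definition minimal_labelling :: "bool stream set \<Rightarrow> (bool stream \<Rightarrow> bool list) \<Rightarrow> bool" where
  "minimal_labelling L b \<longleftrightarrow>
     is_arg_min (\<lambda>b. \<Sum>\<alpha>\<in>L. length (b \<alpha>)) (prefix_free_labelling L) b"

definition phi0 :: "bool stream set \<Rightarrow> bool list set" where
  "phi0 L = (THE B. \<exists>b. minimal_labelling L b \<and> B = b ` L)"

definition p0 :: "bool stream set \<Rightarrow> nat" where
  "p0 L = (\<Sum>\<beta>\<in>phi0 L. length \<beta>)"

definition random_string :: "bool stream measure" where
  "random_string = stream_space (measure_pmf (bernoulli_pmf (1/2)))"

text \<open>The random set \<open>L\<close> is \<open>\<omega> ` {..<n}\<close> for a family \<open>\<omega>\<close> of \<open>n\<close> independent random strings,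
  which are almost surely distinct.\<close>

definition random_strings :: "nat \<Rightarrow> (nat \<Rightarrow> bool stream) measure" where
  "random_strings n = (\<Pi>\<^sub>M i\<in>{..<n}. random_string)"

definition expected_p0 :: "nat \<Rightarrow> real" where
  "expected_p0 n = (\<integral>\<omega>. real (p0 (\<omega> ` {..<n})) \<partial>random_strings n)"

text \<open>Since \<open>ln 0 = 0\<close>, a zero probability gives \<open>R0 n t = 0\<close> instead of infinity; a linear
  growth order excludes both values for all large \<open>n\<close>.\<close>

definition R0 :: "nat \<Rightarrow> real \<Rightarrow> real" where
  "R0 n t = - ln (measure (random_strings n)
     {\<omega> \<in> space (random_strings n). real (p0 (\<omega> ` {..<n})) \<ge> expected_p0 n + t})"

text \<open>\<open>phi0\<close> is well defined: a prefix-free labelling must give each string a label longer than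
  its common prefixes with the other strings, and the shortest such labels are prefix-free.\<close>

lemma prefix_stake_iff:
  "prefix (stake m \<alpha>) (stake k \<alpha>') \<longleftrightarrow> m \<le> k \<and> stake m \<alpha> = stake m \<alpha>'"
proof
  assume p: "prefix (stake m \<alpha>) (stake k \<alpha>')"
  hence le: "m \<le> k" using prefix_length_le by fastforce
  from p have "stake m \<alpha> = take m (stake k \<alpha>')"
    by (metis append_eq_conv_conj length_stake prefixE)
  with le show "m \<le> k \<and> stake m \<alpha> = stake m \<alpha>'" by (simp add: take_stake min_def)
next
  assume "m \<le> k \<and> stake m \<alpha> = stake m \<alpha>'"
  thus "prefix (stake m \<alpha>) (stake k \<alpha>')"
    by (metis min.absorb1 take_is_prefix take_stake)
qed

lemma stake_eq_mono: "stake k \<alpha> = stake k \<alpha>' \<Longrightarrow> m \<le> k \<Longrightarrow> stake m \<alpha> = stake m \<alpha>'"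
  by (metis min.absorb1 take_stake)

lemma ex_stake_neq:
  assumes "\<alpha> \<noteq> \<alpha>'" shows "\<exists>k. stake k \<alpha> \<noteq> stake k \<alpha>'"
proof (rule ccontr)
  assume "\<nexists>k. stake k \<alpha> \<noteq> stake k \<alpha>'"
  hence "\<alpha> !! k = \<alpha>' !! k" for k by (metis lessI stake_nth)
  hence "snth \<alpha> = snth \<alpha>'" by (rule ext)
  hence "\<alpha> = \<alpha>'" by (metis stream_smap_nats)
  with assms show False by simp
qed

lemma phi0_ex1:
  assumes fin: "finite L"
  shows "\<exists>!B. \<exists>b. minimal_labelling L b \<and> B = b ` L"
proof -
  define Q where "Q \<alpha> k \<longleftrightarrow> (\<forall>\<alpha>'\<in>L. \<alpha> \<noteq> \<alpha>' \<longrightarrow> stake k \<alpha> \<noteq> stake k \<alpha>')" for \<alpha> :: "bool stream" and k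
  define d where "d \<alpha> = (LEAST k. Q \<alpha> k)" for \<alpha>
  define b0 where "b0 \<alpha> = stake (d \<alpha>) \<alpha>" for \<alpha>
  have exQ: "\<exists>k. Q \<alpha> k" for \<alpha>
  proof -
    obtain f where f: "\<alpha> \<noteq> \<alpha>' \<Longrightarrow> stake (f \<alpha>') \<alpha> \<noteq> stake (f \<alpha>') \<alpha>'" for \<alpha>'
      using ex_stake_neq by metis
    have "Q \<alpha> (Max (f ` L))" unfolding Q_def
      using f stake_eq_mono fin by (metis Max_ge finite_imageI imageI)
    thus ?thesis ..
  qed
  have Qd: "Q \<alpha> (d \<alpha>)" for \<alpha> unfolding d_def using exQ by (metis LeastI_ex)
  have b0: "prefix_free_labelling L b0"
    using Qd by (auto simp: prefix_free_labelling_def prefix_of_string_def b0_def prefix_stake_iff Q_def)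
  have ge: "d \<alpha> \<le> length (b \<alpha>)" if b: "prefix_free_labelling L b" and \<alpha>: "\<alpha> \<in> L" for b \<alpha>
  proof -
    have st: "b \<alpha>' = stake (length (b \<alpha>')) \<alpha>'" if "\<alpha>' \<in> L" for \<alpha>'
      using b that by (simp add: prefix_free_labelling_def prefix_of_string_def)
    have "Q \<alpha> (length (b \<alpha>))" unfolding Q_def
    proof (intro ballI impI notI)
      fix \<alpha>' assume a: "\<alpha>' \<in> L" "\<alpha> \<noteq> \<alpha>'"
        and e: "stake (length (b \<alpha>)) \<alpha> = stake (length (b \<alpha>)) \<alpha>'"
      have "prefix (b \<alpha>) (b \<alpha>') \<or> prefix (b \<alpha>') (b \<alpha>)"
      proof (cases "length (b \<alpha>) \<le> length (b \<alpha>')")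
        case True
        thus ?thesis using e st[OF \<alpha>] st[OF a(1)] by (metis prefix_stake_iff)
      next
        case False
        hence le: "length (b \<alpha>') \<le> length (b \<alpha>)" by simp
        from stake_eq_mono[OF e le] le show ?thesis
          using st[OF \<alpha>] st[OF a(1)] by (metis prefix_stake_iff)
      qed
      thus False using b \<alpha> a by (auto simp: prefix_free_labelling_def)
    qed
    thus ?thesis unfolding d_def by (rule Least_le)
  qed
  have min0: "minimal_labelling L b0"
    unfolding minimal_labelling_def is_arg_min_linorder
    using b0 ge by (auto intro!: sum_mono simp: b0_def)
  have uniq: "b ` L = b0 ` L" if m: "minimal_labelling L b" for b
  proof -
    from m have b: "prefix_free_labelling L b"
      and le: "(\<Sum>\<alpha>\<in>L. length (b \<alpha>)) \<le> (\<Sum>\<alpha>\<in>L. d \<alpha>)"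
      using b0 by (auto simp: minimal_labelling_def is_arg_min_linorder b0_def dest: spec[of _ b0])
    have "length (b \<alpha>) = d \<alpha>" if "\<alpha> \<in> L" for \<alpha>
    proof (rule ccontr)
      assume "length (b \<alpha>) \<noteq> d \<alpha>"
      hence "d \<alpha> < length (b \<alpha>)" using ge[OF b that] by simp
      hence "(\<Sum>\<alpha>\<in>L. d \<alpha>) < (\<Sum>\<alpha>\<in>L. length (b \<alpha>))"
        using fin that ge[OF b] by (intro sum_strict_mono_ex1) auto
      with le show False by simp
    qed
    hence "b \<alpha> = b0 \<alpha>" if "\<alpha> \<in> L" for \<alpha>
      using b that by (metis prefix_free_labelling_def prefix_of_string_def b0_def)
    thus ?thesis by simp
  qed
  show ?thesis using min0 uniq by blast
qed

end

theory Submission imports Defs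
begin

text \<open>The leaf of a string lies at the first depth where the string differs from all others. By
  Kraft's inequality and convexity, \<open>n\<close> distinct strings that share their first \<open>k\<close> bits
  always have path length at least \<open>n (log 2 n + k)\<close>. As \<open>n\<close> random strings share their first
  \<open>k\<close> bits with probability at least \<open>2 ^ (- k n)\<close>, this bounds the tail from below once the
  mean is known to be at most \<open>n log 2 n + O(n)\<close>.

  Conversely, let \<open>2 ^ m \<ge> n\<close>. Up to a factor of two, the path length in excess of \<open>n m\<close> is at
  most the sum over \<open>i\<close> of the excess over \<open>m\<close> of the depth at which string \<open>i\<close> separates from
  the strings before it. Given those strings, this excess has a geometric tail, hence a bounded
  exponential moment, and integrating the strings out one at a time bounds the exponential moment
  of the sum by \<open>7 ^ n\<close>. Markov's inequality then gives the upper bound of the tail, and Jensen's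
  inequality the bound of the mean.\<close>

section \<open>Separation depths and their sum, the path length\<close>

definition agreements :: "bool stream set \<Rightarrow> bool stream \<Rightarrow> nat set" where
  "agreements L \<alpha> = {k. \<exists>\<beta>\<in>L - {\<alpha>}. stake k \<alpha> = stake k \<beta>}"

text \<open>\<open>agreements L \<alpha>\<close> is an initial segment of the naturals, so its
  cardinality is the least length at which \<alpha> differs from all other strings of
  \<open>L\<close>, and 0 if there are none. The string need not lie in \<open>L\<close>, which
  permits comparison with the earlier strings only.\<close>

definition sep_depth :: "bool stream set \<Rightarrow> bool stream \<Rightarrow> nat" where
  "sep_depth L \<alpha> = card (agreements L \<alpha>)"

lemma finite_agreements:
  assumes "finite L" shows "finite (agreements L \<alpha>)"
proof -
  have "finite {k. stake k \<alpha> = stake k \<beta>}" if "\<beta> \<noteq> \<alpha>" for \<beta> :: "bool stream"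
  proof -
    obtain k where k: "stake k \<alpha> \<noteq> stake k \<beta>" using ex_stake_neq \<open>\<beta> \<noteq> \<alpha>\<close> by metis
    have "{k. stake k \<alpha> = stake k \<beta>} \<subseteq> {..k}"
      using k stake_eq_mono by (metis (mono_tags, lifting) atMost_iff mem_Collect_eq nat_le_linear subsetI)
    thus ?thesis by (rule finite_subset) simp
  qed
  moreover have "agreements L \<alpha> = (\<Union>\<beta>\<in>L - {\<alpha>}. {k. stake k \<alpha> = stake k \<beta>})"
    by (auto simp: agreements_def)
  ultimately show ?thesis using assms by auto
qed

lemma agreements_eq:
  assumes "finite L" shows "agreements L \<alpha> = {..<sep_depth L \<alpha>}"
proof (cases "agreements L \<alpha> = {}")
  case False
  have fin: "finite (agreements L \<alpha>)" by (rule finite_agreements[OF assms])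
  have "agreements L \<alpha> = {..Max (agreements L \<alpha>)}"
  proof (intro equalityI subsetI)
    fix k assume "k \<in> {..Max (agreements L \<alpha>)}"
    thus "k \<in> agreements L \<alpha>"
      using Max_in[OF fin False] stake_eq_mono unfolding agreements_def by blast
  qed (use fin in auto)
  thus ?thesis by (metis sep_depth_def card_atMost lessThan_Suc_atMost)
qed (simp add: sep_depth_def)

lemma less_sep_depth_iff:
  "finite L \<Longrightarrow> k < sep_depth L \<alpha> \<longleftrightarrow> (\<exists>\<beta>\<in>L. \<beta> \<noteq> \<alpha> \<and> stake k \<alpha> = stake k \<beta>)"
  using agreements_eq[of L \<alpha>] unfolding agreements_def by blast

text \<open>If the label of \<alpha> were shorter, it would also be a prefix of some other string
  \<beta> of \<open>L\<close>. The labels of \<alpha> and \<beta> would then be prefixes of one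
  string, hence comparable.\<close>

lemma sep_depth_le_label_length:
  assumes fin: "finite L" and b: "prefix_free_labelling L b" and \<alpha>: "\<alpha> \<in> L"
  shows "sep_depth L \<alpha> \<le> length (b \<alpha>)"
proof (rule ccontr)
  assume "\<not> ?thesis"
  then obtain \<beta> where \<beta>: "\<beta> \<in> L" "\<beta> \<noteq> \<alpha>" and eq: "stake (length (b \<alpha>)) \<alpha> = stake (length (b \<alpha>)) \<beta>"
    using less_sep_depth_iff[OF fin] by (metis not_le)
  have st: "stake (length (b \<alpha>)) \<alpha> = b \<alpha>" "stake (length (b \<beta>)) \<beta> = b \<beta>"
    using b \<alpha> \<beta> by (auto simp: prefix_free_labelling_def prefix_of_string_def)
  have "\<not> prefix (b \<alpha>) (b \<beta>)" "\<not> prefix (b \<beta>) (b \<alpha>)"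
    using b \<alpha> \<beta> by (auto simp: prefix_free_labelling_def)
  thus False
    using prefix_stake_iff[of "length (b \<alpha>)" \<beta> "length (b \<beta>)" \<beta>]
      prefix_stake_iff[of "length (b \<beta>)" \<beta> "length (b \<alpha>)" \<beta>] eq st
    by (metis nat_le_linear)
qed

text \<open>Cutting every string at its separation depth gives a prefix-free labelling that is
  minimal string by string. Prefix-freeness makes it injective, so summing over labels or over
  strings is the same.\<close>

lemma p0_eq_sum_sep_depth:
  assumes fin: "finite L" shows "p0 L = (\<Sum>\<alpha>\<in>L. sep_depth L \<alpha>)"
proof -
  define b where "b \<alpha> = stake (sep_depth L \<alpha>) \<alpha>" for \<alpha>
  have pf: "prefix_free_labelling L b"
    unfolding prefix_free_labelling_def prefix_of_string_def b_def prefix_stake_iff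
    using less_sep_depth_iff[OF fin] by (metis length_stake less_irrefl)
  have "minimal_labelling L b"
    unfolding minimal_labelling_def is_arg_min_linorder
    using pf sep_depth_le_label_length[OF fin] by (simp add: b_def sum_mono)
  hence "phi0 L = b ` L"
    unfolding phi0_def by (intro the1_equality[OF phi0_ex1[OF fin]]) auto
  moreover have "inj_on b L"
    using pf unfolding prefix_free_labelling_def by (metis inj_onI prefix_order.refl)
  moreover have "length (b \<alpha>) = sep_depth L \<alpha>" for \<alpha>
    by (simp add: b_def)
  ultimately show ?thesis
    by (simp add: p0_def sum.reindex)
qed

section \<open>Cylinder probabilities, Kraft's inequality and the lower bound on the path
  length\<close>

lemma space_random_string [simp]: "space random_string = UNIV"
  by (simp add: random_string_def space_stream_space)

lemma sets_random_string [measurable_cong]: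
  "sets random_string = sets (stream_space (count_space UNIV))"
  unfolding random_string_def by (intro sets_stream_space_cong) simp

lemma prob_space_random_string: "prob_space random_string"
  unfolding random_string_def by (intro prob_space.prob_space_stream_space) unfold_locales

lemma measurable_stake_random_string [measurable]:
  "stake k \<in> measurable random_string (count_space UNIV)"
  by measurable

lemma cylinder_in_sets [measurable]: "{x. stake k x = w} \<in> sets random_string"
  using measurable_sets[OF measurable_stake_random_string, of "{w}" k] by (simp add: vimage_def)

lemma emeasure_cylinder:
  "emeasure random_string {x. stake (length w) x = w} = ennreal ((1/2) ^ length w)"
proof (induction w)
  case Nil
  thus ?case using prob_space.emeasure_space_1[OF prob_space_random_string] by simp
next
  case (Cons a w)
  have "{x. stake (length (a # w)) x = a # w} \<in> sets random_string"
    by (rule cylinder_in_sets)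
  hence "emeasure random_string {x. stake (length (a # w)) x = a # w} =
    (\<integral>\<^sup>+t. emeasure random_string {x. t = a \<and> stake (length w) x = w}
      \<partial>measure_pmf (bernoulli_pmf (1/2)))"
    unfolding random_string_def
    by (subst prob_space.emeasure_stream_space[OF prob_space_measure_pmf]) (auto simp: space_stream_space)
  also have "\<dots> = (\<integral>\<^sup>+t. ennreal ((1/2) ^ length w) * indicator {a} t \<partial>measure_pmf (bernoulli_pmf (1/2)))"
    using Cons.IH by (intro nn_integral_cong) (auto split: split_indicator)
  also have "\<dots> = ennreal ((1/2) ^ length w) * ennreal (1/2)"
    by (subst nn_integral_cmult_indicator) (auto simp: emeasure_pmf_single pmf_bernoulli_half)
  also have "\<dots> = ennreal ((1/2) ^ length (a # w))"
    by (subst ennreal_mult[symmetric]) simp_all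
  finally show ?case .
qed

lemma measure_cylinder:
  "measure random_string {x. stake k x = stake k \<alpha>} = (1/2) ^ k"
  using emeasure_cylinder[of "stake k \<alpha>"] by (simp add: measure_def)

text \<open>The cylinders of the labels are disjoint events contained in the cylinder of the common
  prefix.\<close>

lemma kraft_sep_depth:
  assumes fin: "finite L" and le: "\<And>\<alpha>. \<alpha> \<in> L \<Longrightarrow> k \<le> sep_depth L \<alpha>"
    and eq: "\<And>\<alpha>. \<alpha> \<in> L \<Longrightarrow> stake k \<alpha> = stake k \<gamma>"
  shows "(\<Sum>\<alpha>\<in>L. (1/2::real) ^ sep_depth L \<alpha>) \<le> (1/2) ^ k"
proof -
  interpret prob_space random_string by (rule prob_space_random_string)
  define A where "A \<alpha> = {x. stake (sep_depth L \<alpha>) x = stake (sep_depth L \<alpha>) \<alpha>}" for \<alpha>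
  have A[measurable]: "A \<alpha> \<in> sets random_string" for \<alpha>
    unfolding A_def by (rule cylinder_in_sets)
  \<comment> \<open>A common point of both cylinders forces the two strings to agree up to the
    smaller depth, where \<alpha> is already separated from all others.\<close>
  have *: "\<alpha> = \<beta>" if "x \<in> A \<alpha>" "x \<in> A \<beta>" "\<alpha> \<in> L" "\<beta> \<in> L" "sep_depth L \<alpha> \<le> sep_depth L \<beta>" for x \<alpha> \<beta>
  proof -
    have "stake (sep_depth L \<alpha>) \<alpha> = stake (sep_depth L \<alpha>) \<beta>"
      using that stake_eq_mono[of "sep_depth L \<beta>" x \<beta> "sep_depth L \<alpha>"] by (simp add: A_def)
    thus ?thesis using less_sep_depth_iff[OF fin, of "sep_depth L \<alpha>" \<alpha>] that by auto
  qed
  have "disjoint_family_on A L"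
    unfolding disjoint_family_on_def using * by (metis disjoint_iff nat_le_linear)
  hence "(\<Sum>\<alpha>\<in>L. measure random_string (A \<alpha>)) = measure random_string (\<Union>\<alpha>\<in>L. A \<alpha>)"
    using fin by (intro finite_measure_finite_Union[symmetric]) auto
  also have "\<dots> \<le> measure random_string {x. stake k x = stake k \<gamma>}"
  proof (rule finite_measure_mono)
    show "(\<Union>\<alpha>\<in>L. A \<alpha>) \<subseteq> {x. stake k x = stake k \<gamma>}"
      unfolding A_def using le eq stake_eq_mono by fastforce
  qed (rule cylinder_in_sets)
  finally show ?thesis by (simp add: A_def measure_cylinder)
qed

lemma p0_lower_bound:
  assumes fin: "finite L" and n: "card L = n" "n > 0" and k: "k = 0 \<or> n \<ge> 2"
    and eq: "\<And>\<alpha>. \<alpha> \<in> L \<Longrightarrow> stake k \<alpha> = stake k \<gamma>"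
  shows "real n * (log 2 (real n) + real k) \<le> real (p0 L)"
proof -
  \<comment> \<open>A lone string has depth 0 whatever its prefix, so a positive \<open>k\<close>
    needs a second string.\<close>
  have le: "k \<le> sep_depth L \<alpha>" if "\<alpha> \<in> L" for \<alpha>
  proof (cases "k = 0")
    case False
    hence "L \<noteq> {\<alpha>}" using k n by auto
    then obtain \<beta> where "\<beta> \<in> L" "\<beta> \<noteq> \<alpha>" using \<open>\<alpha> \<in> L\<close> by auto
    thus ?thesis using less_sep_depth_iff[OF fin, of k \<alpha>] eq that by force
  qed auto
  \<comment> \<open>The scaling makes the mean of \<open>z\<close> at most 1 by Kraft's inequality.
    Summing \<open>ln z \<le> z - 1\<close> is then Jensen's inequality for the logarithm.\<close>
  define z where "z \<alpha> = real n * 2 ^ k * (1/2) ^ sep_depth L \<alpha>" for \<alpha>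
  have ln_z: "ln (z \<alpha>) = ln (real n) + real k * ln 2 - real (sep_depth L \<alpha>) * ln 2" for \<alpha>
    using n by (simp add: z_def ln_mult ln_realpow power_divide ln_div)
  have "(\<Sum>\<alpha>\<in>L. ln (z \<alpha>)) \<le> (\<Sum>\<alpha>\<in>L. z \<alpha> - 1)"
    using n by (intro sum_mono ln_le_minus_one) (simp add: z_def)
  also have "\<dots> = real n * 2 ^ k * (\<Sum>\<alpha>\<in>L. (1/2) ^ sep_depth L \<alpha>) - real n"
    using n by (simp add: z_def sum_subtractf sum_distrib_left)
  also have "\<dots> \<le> real n * 2 ^ k * (1/2) ^ k - real n"
    using kraft_sep_depth[OF fin le eq] by (intro diff_right_mono mult_left_mono) auto
  also have "\<dots> = 0" by (simp add: power_divide)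
  finally have "real n * (ln (real n) + real k * ln 2) \<le> real (p0 L) * ln 2"
    using n by (simp add: ln_z p0_eq_sum_sep_depth[OF fin] sum.distrib sum_subtractf
        sum_distrib_right[symmetric] algebra_simps)
  moreover have "ln (real n) = log 2 (real n) * ln 2" by (simp add: log_def)
  ultimately have "(real n * (log 2 (real n) + real k)) * ln 2 \<le> real (p0 L) * ln 2"
    by (simp add: algebra_simps)
  thus ?thesis by simp
qed

section \<open>Measurability of the path length\<close>

text \<open>Replaces a sum over a set that varies with the outcome by a sum over fixed indices, even
  where strings coincide: each value counts at its first index only.\<close>

lemma sum_image_first_occurrence:
  fixes g :: "'a \<Rightarrow> 'b::comm_monoid_add"
  shows "(\<Sum>x\<in>f ` {..<n::nat}. g x) = (\<Sum>i<n. if \<exists>j<i. f j = f i then 0 else g (f i))"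
proof (induction n)
  case (Suc n)
  have image: "f ` {..<Suc n} = insert (f n) (f ` {..<n})" by (auto simp: lessThan_Suc)
  have mem: "(\<exists>j<n. f j = f n) \<longleftrightarrow> f n \<in> f ` {..<n}" by (metis imageE image_eqI lessThan_iff)
  show ?case
    unfolding image sum.lessThan_Suc mem Suc.IH[symmetric]
    by (cases "f n \<in> f ` {..<n}") (simp_all add: insert_absorb add.commute)
qed simp

lemma measurable_stake_component [measurable]:
  assumes "i < n"
  shows "(\<lambda>\<omega>. stake k (\<omega> i)) \<in> measurable (random_strings n) (count_space UNIV)"
  unfolding random_strings_def
  by (rule measurable_compose[OF _ measurable_stake_random_string])
    (use assms in \<open>auto intro: measurable_component_singleton\<close>)

lemma measurable_p0 [measurable]:
  "(\<lambda>\<omega>. real (p0 (\<omega> ` {..<n}))) \<in> borel_measurable (random_strings n)"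
proof -
  \<comment> \<open>Equality of strings becomes a countable conjunction of measurable
    conditions.\<close>
  have eq: "(\<alpha> = \<beta>) = (\<forall>k. stake k \<alpha> = stake k \<beta>)" for \<alpha> \<beta> :: "bool stream"
    using ex_stake_neq by metis
  have [measurable]: "Measurable.pred (random_strings n) (\<lambda>\<omega>. \<omega> j = \<omega> i)" if "i < n" "j < n" for i j
    unfolding eq using that by measurable
  have p0_eq: "p0 (\<omega> ` {..<n}) = (\<Sum>i<n. if \<exists>j<i. \<omega> j = \<omega> i then 0 else
      card {k. \<exists>j\<in>{..<n}. \<omega> j \<noteq> \<omega> i \<and> stake k (\<omega> i) = stake k (\<omega> j)})" for \<omega>
  proof -
    have "sep_depth (\<omega> ` {..<n}) \<alpha> = card {k. \<exists>j\<in>{..<n}. \<omega> j \<noteq> \<alpha> \<and> stake k \<alpha> = stake k (\<omega> j)}" for \<alpha>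
      unfolding sep_depth_def agreements_def by (rule arg_cong[where f=card]) auto
    thus ?thesis
      by (simp add: p0_eq_sum_sep_depth sum_image_first_occurrence cong: if_cong)
  qed
  moreover have "(\<lambda>\<omega>. real (if \<exists>j<i. \<omega> j = \<omega> i then 0 else
      card {k. \<exists>j\<in>{..<n}. \<omega> j \<noteq> \<omega> i \<and> stake k (\<omega> i) = stake k (\<omega> j)}))
      \<in> borel_measurable (random_strings n)" if "i < n" for i
  proof -
    have [measurable]: "Measurable.pred (random_strings n) (\<lambda>\<omega>. \<exists>j\<in>{..<i}. \<omega> j = \<omega> i)"
      using that by (intro pred_intros_finite) auto
    have [measurable]: "Measurable.pred (random_strings n)
        (\<lambda>\<omega>. \<exists>j\<in>{..<n}. \<omega> j \<noteq> \<omega> i \<and> stake k (\<omega> i) = stake k (\<omega> j))" for k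
      using that by (intro pred_intros_finite) auto
    have "(\<exists>j<i. \<omega> j = \<omega> i) \<longleftrightarrow> (\<exists>j\<in>{..<i}. \<omega> j = \<omega> i)" for \<omega> :: "nat \<Rightarrow> bool stream"
      by auto
    thus ?thesis by simp
  qed
  ultimately show ?thesis
    unfolding p0_eq of_nat_sum by (intro borel_measurable_sum) (simp only: lessThan_iff)
qed


section \<open>The collision weights and the integral of their product\<close>

text \<open>A majorant of \<open>(3/2)\<close> to the power of the excess over \<open>m\<close> of the separation depth of
  \<open>\<alpha>\<close> from the first \<open>i\<close> strings. It is linear in the collision indicators, hence easy to
  integrate, and infinite if \<open>\<alpha>\<close> is one of these strings, so that its integrability also shows that the
  strings are almost surely distinct.\<close>

definition collision_weight :: "nat \<Rightarrow> nat \<Rightarrow> (nat \<Rightarrow> bool stream) \<Rightarrow> bool stream \<Rightarrow> ennreal" where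
  "collision_weight m i \<omega> \<alpha> =
     1 + (\<Sum>r. \<Sum>j<i. if stake (m + r) \<alpha> = stake (m + r) (\<omega> j) then ennreal ((3/2) ^ Suc r) else 0)"

lemma collision_weight_ge:
  assumes "j < i" and "stake (m + r) \<alpha> = stake (m + r) (\<omega> j)"
  shows "ennreal ((3/2) ^ Suc r) \<le> collision_weight m i \<omega> \<alpha>"
proof -
  define f where "f s l = (if stake (m + s) \<alpha> = stake (m + s) (\<omega> l) then ennreal ((3/2) ^ Suc s) else 0)" for s l
  have "ennreal ((3/2) ^ Suc r) = (\<Sum>l\<in>{j}. f r l)" using assms by (simp add: f_def)
  also have "\<dots> \<le> (\<Sum>l<i. f r l)" using assms by (intro sum_mono2) auto
  also have "\<dots> = (\<Sum>s\<in>{r}. \<Sum>l<i. f s l)" by simp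
  also have "\<dots> \<le> (\<Sum>s. \<Sum>l<i. f s l)" by (intro sum_le_suminf) auto
  also have "\<dots> \<le> collision_weight m i \<omega> \<alpha>"
    by (simp add: collision_weight_def f_def add_increasing)
  finally show ?thesis .
qed

lemma power_sep_depth_le_collision_weight:
  "ennreal ((3/2) ^ (sep_depth (\<omega> ` {..<i}) \<alpha> - m)) \<le> collision_weight m i \<omega> \<alpha>"
proof (cases "sep_depth (\<omega> ` {..<i}) \<alpha> - m")
  case 0
  \<comment> \<open>The summand 1 of the weight covers excess zero.\<close>
  thus ?thesis by (simp add: collision_weight_def)
next
  case (Suc r)
  \<comment> \<open>Excess \<open>Suc r\<close> means agreement on \<open>m + r\<close> bits, hence
    the exponent \<open>Suc r\<close> in the weight of level \<open>r\<close>.\<close>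
  hence "m + r < sep_depth (\<omega> ` {..<i}) \<alpha>" by simp
  then obtain j where "j < i" "stake (m + r) \<alpha> = stake (m + r) (\<omega> j)"
    using less_sep_depth_iff[of "\<omega> ` {..<i}"] by auto
  thus ?thesis unfolding Suc by (rule collision_weight_ge)
qed

text \<open>A repeated string collides at every level, and the weights of the levels are
  unbounded.\<close>

lemma collision_weight_eq_top:
  assumes "j < i" and "\<alpha> = \<omega> j"
  shows "collision_weight m i \<omega> \<alpha> = \<top>"
proof (rule ccontr)
  assume "collision_weight m i \<omega> \<alpha> \<noteq> \<top>"
  then obtain w where w: "collision_weight m i \<omega> \<alpha> = ennreal w" "w \<ge> 0"
    by (metis ennreal_cases)
  obtain r where "w < (3/2) ^ r" using real_arch_pow[of "3/2" w] by auto
  also have "(3/2::real) ^ r \<le> (3/2) ^ Suc r" by simp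
  also have "ennreal \<dots> \<le> ennreal w" unfolding w(1)[symmetric]
    by (rule collision_weight_ge) (use assms in auto)
  hence "(3/2::real) ^ Suc r \<le> w" using w by (simp add: ennreal_le_iff)
  finally show False by simp
qed

text \<open>Each of at most \<open>2 ^ m\<close> strings is matched on \<open>m + r\<close> bits
  with probability \<open>(1/2) ^ (m + r)\<close>, so level \<open>r\<close> contributes at most
  \<open>3/2 * (3/4) ^ r\<close>. These terms sum to 6, and the constant summand makes 7. A base
  below 2 keeps the series convergent.\<close>

lemma nn_integral_collision_weight:
  assumes "i \<le> 2 ^ m"
  shows "(\<integral>\<^sup>+\<alpha>. collision_weight m i \<omega> \<alpha> \<partial>random_string) \<le> 7"
proof -
  interpret prob_space random_string by (rule prob_space_random_string)
  have eq: "(if stake (m + r) \<alpha> = stake (m + r) (\<omega> j) then ennreal ((3/2) ^ Suc r) else 0) =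
      ennreal ((3/2) ^ Suc r) * indicator {x. stake (m + r) x = stake (m + r) (\<omega> j)} \<alpha>" for r j \<alpha>
    by simp
  have cyl: "emeasure random_string {x. stake k x = stake k \<beta>} = ennreal ((1/2) ^ k)" for k \<beta>
    using emeasure_cylinder[of "stake k \<beta>"] by simp
  have term_le: "(\<Sum>j<i. ennreal ((3/2) ^ Suc r) * ennreal ((1/2) ^ (m + r))) \<le> ennreal (3/2 * (3/4) ^ r)" for r
  proof -
    have "(\<Sum>j<i. ennreal ((3/2) ^ Suc r) * ennreal ((1/2) ^ (m + r))) =
        ennreal (real i * ((3/2) ^ Suc r * (1/2) ^ (m + r)))"
      by (simp add: ennreal_mult[symmetric] ennreal_of_nat_eq_real_of_nat del: power_Suc)
    also have "real i * ((3/2) ^ Suc r * (1/2) ^ (m + r)) = (real i / 2 ^ m) * (3/2 * (3/4) ^ r)"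
      by (simp add: power_add power_divide field_simps flip: power_mult_distrib)
    also have "\<dots> \<le> 1 * (3/2 * (3/4) ^ r)"
    proof (rule mult_right_mono)
      have "real i \<le> 2 ^ m" using assms by (metis of_nat_le_iff of_nat_numeral of_nat_power)
      thus "real i / 2 ^ m \<le> 1" by simp
    qed simp
    finally show ?thesis by (simp add: ennreal_leI)
  qed
  have "(\<integral>\<^sup>+\<alpha>. collision_weight m i \<omega> \<alpha> \<partial>random_string) =
      1 + (\<Sum>r. \<Sum>j<i. ennreal ((3/2) ^ Suc r) * ennreal ((1/2) ^ (m + r)))"
  proof -
    have meas1: "(\<lambda>\<alpha>. ennreal ((3/2) ^ Suc r) *
        indicator {x. stake (m + r) x = stake (m + r) (\<omega> j)} \<alpha>) \<in> borel_measurable random_string" for r j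
      by (intro borel_measurable_times_ennreal borel_measurable_indicator
          cylinder_in_sets borel_measurable_const)
    have meas: "(\<lambda>\<alpha>. \<Sum>j<i. ennreal ((3/2) ^ Suc r) *
        indicator {x. stake (m + r) x = stake (m + r) (\<omega> j)} \<alpha>) \<in> borel_measurable random_string" for r
      by (intro borel_measurable_sum meas1)
    have "(\<integral>\<^sup>+\<alpha>. (\<Sum>j<i. ennreal ((3/2) ^ Suc r) *
        indicator {x. stake (m + r) x = stake (m + r) (\<omega> j)} \<alpha>) \<partial>random_string) =
        (\<Sum>j<i. ennreal ((3/2) ^ Suc r) * ennreal ((1/2) ^ (m + r)))" for r
      by (simp only: nn_integral_sum[OF meas1] nn_integral_cmult_indicator[OF cylinder_in_sets] cyl)
    thus ?thesis
      unfolding collision_weight_def eq using emeasure_space_1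
      by (subst nn_integral_add)
        (auto simp only: nn_integral_suminf[OF meas] nn_integral_const mult_1
          intro!: borel_measurable_suminf_order meas borel_measurable_const)
  qed
  also have "\<dots> \<le> 1 + (\<Sum>r. ennreal (3/2 * (3/4) ^ r))"
    by (intro add_left_mono suminf_le term_le) auto
  also have "(\<Sum>r. ennreal (3/2 * (3/4) ^ r)) = ennreal 6"
  proof (rule suminf_ennreal_eq)
    show "(\<lambda>r. 3/2 * (3/4::real) ^ r) sums 6"
      using sums_mult[OF geometric_sums[of "3/4::real"], of "3/2"] by simp
  qed simp
  also have "1 + ennreal 6 = 7" by simp
  finally show ?thesis .
qed

lemma measurable_collision_weight [measurable]:
  assumes "i < n"
  shows "(\<lambda>\<omega>. collision_weight m i \<omega> (\<omega> i)) \<in> borel_measurable (random_strings n)"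
proof -
  have [measurable]: "Measurable.pred (random_strings n) (\<lambda>\<omega>. stake k (\<omega> i) = stake k (\<omega> j))" if "j < i" for j k
  proof -
    have "j < n" using assms that by simp
    thus ?thesis using assms by measurable
  qed
  show ?thesis unfolding collision_weight_def
    by (intro borel_measurable_add borel_measurable_suminf_order borel_measurable_sum) auto
qed

lemma nn_integral_prod_collision_weight:
  "n \<le> 2 ^ m \<Longrightarrow>
    (\<integral>\<^sup>+\<omega>. (\<Prod>i<n. collision_weight m i \<omega> (\<omega> i)) \<partial>random_strings n) \<le> 7 ^ n"
proof (induction n)
  case 0
  interpret prob_space "random_strings 0"
    unfolding random_strings_def by (intro prob_space_PiM prob_space_random_string)
  show ?case by (simp add: emeasure_space_1)
next
  case (Suc n)
  interpret P: product_sigma_finite "\<lambda>_::nat. random_string"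
    by (intro product_sigma_finite.intro prob_space_imp_sigma_finite prob_space_random_string)
  \<comment> \<open>The weights of index at most \<open>n\<close> look only at strings of smaller
    index. Hence the new string \<open>y\<close> enters the last factor alone, as its
    argument.\<close>
  have upd: "collision_weight m i (fun_upd \<omega> n y) \<alpha> = collision_weight m i \<omega> \<alpha>" if "i \<le> n" for i \<omega> y \<alpha>
    unfolding collision_weight_def using that
    by (intro arg_cong2[where f="(+)"] refl suminf_cong sum.cong if_cong) auto
  have [measurable]: "(\<lambda>\<omega>. \<Prod>i<Suc n. collision_weight m i \<omega> (\<omega> i)) \<in> borel_measurable (random_strings (Suc n))"
    by (intro borel_measurable_prod_ennreal measurable_collision_weight) auto
  have [measurable]: "(\<lambda>\<omega>. \<Prod>i<n. collision_weight m i \<omega> (\<omega> i)) \<in> borel_measurable (random_strings n)"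
    by (intro borel_measurable_prod_ennreal measurable_collision_weight) auto
  have [measurable]: "(\<lambda>\<alpha>. collision_weight m n \<omega> \<alpha>) \<in> borel_measurable random_string" for \<omega>
    unfolding collision_weight_def by measurable
  have "(\<integral>\<^sup>+\<omega>. (\<Prod>i<Suc n. collision_weight m i \<omega> (\<omega> i)) \<partial>random_strings (Suc n)) =
      (\<integral>\<^sup>+\<omega>. (\<integral>\<^sup>+y. (\<Prod>i<Suc n. collision_weight m i (fun_upd \<omega> n y) (fun_upd \<omega> n y i)) \<partial>random_string)
        \<partial>random_strings n)"
    unfolding random_strings_def lessThan_Suc[of n]
    by (subst P.product_nn_integral_insert)
      (use \<open>_ \<in> borel_measurable (random_strings (Suc n))\<close> in \<open>auto simp: random_strings_def lessThan_Suc\<close>)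
  also have "\<dots> = (\<integral>\<^sup>+\<omega>. (\<integral>\<^sup>+y. (\<Prod>i<n. collision_weight m i \<omega> (\<omega> i)) * collision_weight m n \<omega> y
      \<partial>random_string) \<partial>random_strings n)"
    by (intro nn_integral_cong) (simp add: upd)
  also have "\<dots> = (\<integral>\<^sup>+\<omega>. (\<Prod>i<n. collision_weight m i \<omega> (\<omega> i)) *
      (\<integral>\<^sup>+y. collision_weight m n \<omega> y \<partial>random_string) \<partial>random_strings n)"
    by (intro nn_integral_cong nn_integral_cmult) measurable
  also have "\<dots> \<le> (\<integral>\<^sup>+\<omega>. (\<Prod>i<n. collision_weight m i \<omega> (\<omega> i)) * 7 \<partial>random_strings n)"
    using Suc.prems by (intro nn_integral_mono mult_left_mono nn_integral_collision_weight) auto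
  also have "\<dots> = (\<integral>\<^sup>+\<omega>. (\<Prod>i<n. collision_weight m i \<omega> (\<omega> i)) \<partial>random_strings n) * 7"
    by (intro nn_integral_multc) measurable
  also have "\<dots> \<le> 7 ^ n * 7"
    using Suc by (intro mult_right_mono) auto
  finally show ?case by (simp add: mult.commute)
qed

section \<open>The exponential moment of the path length\<close>

text \<open>At each level, a string that collides only with later strings is matched with one of
  these, so counting collisions with earlier strings only loses at most a factor of two.\<close>

lemma p0_upper_bound:
  assumes inj: "inj_on \<omega> {..<n}"
  shows "p0 (\<omega> ` {..<n}) \<le> n * m + 2 * (\<Sum>i<n. sep_depth (\<omega> ` {..<i}) (\<omega> i) - m)"
proof -
  define d where "d i = sep_depth (\<omega> ` {..<n}) (\<omega> i)" for i
  define e where "e i = sep_depth (\<omega> ` {..<i}) (\<omega> i)" for i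
  \<comment> \<open>Pairs of an index and a level of at least \<open>m\<close>: in \<open>A\<close>
    the string collides there with any other string, in \<open>B\<close> with an earlier one. The
    cardinalities are the two sums of excesses.\<close>
  define A where "A = (SIGMA i:{..<n}. {m..<d i})"
  define B where "B = (SIGMA i:{..<n}. {m..<e i})"
  have fin: "finite A" "finite B" by (auto simp: A_def B_def)
  have d: "k < d i \<longleftrightarrow> (\<exists>j<n. j \<noteq> i \<and> stake k (\<omega> i) = stake k (\<omega> j))" if "i < n" for i k
    using inj that by (auto simp: d_def less_sep_depth_iff inj_on_def)
  have e: "k < e i \<longleftrightarrow> (\<exists>j<i. stake k (\<omega> i) = stake k (\<omega> j))" if "i < n" for i k
  proof -
    have "\<omega> j \<noteq> \<omega> i" if "j < i" for j
      using inj_onD[OF inj, of j i] \<open>i < n\<close> that by auto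
    thus ?thesis by (auto simp: e_def less_sep_depth_iff)
  qed
  have "\<exists>j. (j, k) \<in> B \<and> stake k (\<omega> i) = stake k (\<omega> j)" if "(i, k) \<in> A - B" for i k
  proof -
    have ik: "i < n" "m \<le> k" "k < d i" "\<not> k < e i" using that by (auto simp: A_def B_def)
    then obtain j where j: "j < n" "j \<noteq> i" "stake k (\<omega> i) = stake k (\<omega> j)" using d by blast
    hence "i < j" using ik e by (metis linorder_neqE_nat)
    hence "k < e j" using e[OF j(1)] j(3) by metis
    thus ?thesis using ik j by (auto simp: B_def)
  qed
  then obtain f where f: "\<And>i k. (i, k) \<in> A - B \<Longrightarrow> (f i k, k) \<in> B \<and> stake k (\<omega> i) = stake k (\<omega> (f i k))"
    by metis
  have "card (A - B) \<le> card B"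
  proof (rule card_inj_on_le)
    \<comment> \<open>Two indices with the same image agree at level \<open>k\<close>, so the larger
      would collide with an earlier string and its pair would lie in \<open>B\<close>.\<close>
    show "inj_on (\<lambda>(i, k). (f i k, k)) (A - B)"
    proof (rule inj_onI, clarsimp)
      fix i k i' assume a: "(i, k) \<in> A" "(i, k) \<notin> B" "(i', k) \<in> A" "(i', k) \<notin> B" and ff: "f i k = f i' k"
      hence eq: "stake k (\<omega> i) = stake k (\<omega> i')" using f[of i k] f[of i' k] by auto
      have "i < n" "\<not> k < e i" "i' < n" "\<not> k < e i'" using a by (auto simp: A_def B_def)
      thus "i = i'" using e eq by (metis linorder_neqE_nat)
    qed
    show "(\<lambda>(i, k). (f i k, k)) ` (A - B) \<subseteq> B" using f by auto
  qed (use fin in auto)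
  hence "card A \<le> 2 * card B"
    using fin card_mono[of "(A - B) \<union> B" A] card_Un_le[of "A - B" B] by simp
  moreover have "card A = (\<Sum>i<n. d i - m)" "card B = (\<Sum>i<n. e i - m)"
    by (simp_all add: A_def B_def)
  moreover have "(\<Sum>i<n. d i) \<le> (\<Sum>i<n. m + (d i - m))" by (intro sum_mono) auto
  hence "(\<Sum>i<n. d i) \<le> n * m + (\<Sum>i<n. d i - m)" by (simp add: sum.distrib)
  moreover have "p0 (\<omega> ` {..<n}) = (\<Sum>i<n. d i)"
    using inj by (simp add: p0_eq_sum_sep_depth sum.reindex d_def)
  ultimately show ?thesis unfolding e_def by linarith
qed

lemma prob_space_random_strings: "prob_space (random_strings n)"
  unfolding random_strings_def by (intro prob_space_PiM prob_space_random_string)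

lemma AE_prod_collision_weight_finite:
  "AE \<omega> in random_strings n. (\<Prod>i<n. collision_weight n i \<omega> (\<omega> i)) \<noteq> \<top>"
proof -
  have "(\<integral>\<^sup>+\<omega>. (\<Prod>i<n. collision_weight n i \<omega> (\<omega> i)) \<partial>random_strings n) \<le> 7 ^ n"
    \<comment> \<open>Any \<open>m\<close> with \<open>n \<le> 2 ^ m\<close> serves for finiteness;
      here \<open>m = n\<close>.\<close>
    by (intro nn_integral_prod_collision_weight less_imp_le less_exp)
  also have "(7::ennreal) ^ n < \<top>" by (simp add: power_less_top_ennreal)
  finally show ?thesis unfolding infinity_ennreal_def[symmetric]
    by (intro nn_integral_PInf_AE borel_measurable_prod_ennreal measurable_collision_weight) auto
qed

lemma AE_inj_on: "AE \<omega> in random_strings n. inj_on \<omega> {..<n}"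
  using AE_prod_collision_weight_finite
proof eventually_elim
  case (elim \<omega>)
  have "\<omega> i \<noteq> \<omega> j" if "j < i" "i < n" for i j
  proof
    assume "\<omega> i = \<omega> j"
    hence "collision_weight n i \<omega> (\<omega> i) = \<top>" using that collision_weight_eq_top by metis
    \<comment> \<open>In \<open>ennreal\<close> zero times infinity is zero, so an infinite factor
      makes the product infinite only because no factor vanishes.\<close>
    moreover have "collision_weight n l \<omega> (\<omega> l) \<noteq> 0" for l
      by (simp add: collision_weight_def)
    ultimately show False using elim that by (auto simp: ennreal_prod_eq_top)
  qed
  thus ?case by (metis inj_onI lessThan_iff linorder_neqE_nat)
qed

text \<open>The halved rate \<open>ln (3/2) / 2\<close> absorbs the factor 2 of
  \<open>p0_upper_bound\<close>. What remains is \<open>3/2\<close> to the sum of the excesses,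
  dominated factor by factor by the collision weights.\<close>

lemma nn_integral_exp_p0:
  assumes "n \<le> 2 ^ m"
  shows "(\<integral>\<^sup>+\<omega>. ennreal (exp (ln (3/2) / 2 * (real (p0 (\<omega> ` {..<n})) - real n * real m)))
    \<partial>random_strings n) \<le> 7 ^ n"
proof -
  have "AE \<omega> in random_strings n.
    ennreal (exp (ln (3/2) / 2 * (real (p0 (\<omega> ` {..<n})) - real n * real m)))
      \<le> (\<Prod>i<n. collision_weight m i \<omega> (\<omega> i))"
    using AE_inj_on
  proof eventually_elim
    case (elim \<omega>)
    define e where "e i = sep_depth (\<omega> ` {..<i}) (\<omega> i) - m" for i
    have "real (p0 (\<omega> ` {..<n})) \<le> real (n * m + 2 * (\<Sum>i<n. e i))"
      using p0_upper_bound[OF elim, of m] by (simp only: of_nat_le_iff e_def)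
    hence "ln (3/2) / 2 * (real (p0 (\<omega> ` {..<n})) - real n * real m) \<le> ln (3/2) / 2 * (2 * real (\<Sum>i<n. e i))"
      by (intro mult_left_mono) auto
    hence "exp (ln (3/2) / 2 * (real (p0 (\<omega> ` {..<n})) - real n * real m))
        \<le> exp (real (\<Sum>i<n. e i) * ln (3/2))"
      by (simp add: mult.commute)
    also have "\<dots> = (3/2) ^ (\<Sum>i<n. e i)" by (simp only: exp_of_nat_mult) simp
    also have "\<dots> = (\<Prod>i<n. (3/2) ^ e i)" by (simp add: power_sum)
    also have "ennreal \<dots> = (\<Prod>i<n. ennreal ((3/2) ^ e i))" by (simp add: prod_ennreal)
    also have "\<dots> \<le> (\<Prod>i<n. collision_weight m i \<omega> (\<omega> i))"
      unfolding e_def by (intro prod_mono_ennreal power_sep_depth_le_collision_weight)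
    finally show ?case by (simp add: ennreal_leI)
  qed
  hence "(\<integral>\<^sup>+\<omega>. ennreal (exp (ln (3/2) / 2 * (real (p0 (\<omega> ` {..<n})) - real n * real m)))
    \<partial>random_strings n) \<le> (\<integral>\<^sup>+\<omega>. (\<Prod>i<n. collision_weight m i \<omega> (\<omega> i)) \<partial>random_strings n)"
    by (rule nn_integral_mono_AE)
  also have "\<dots> \<le> 7 ^ n" by (rule nn_integral_prod_collision_weight[OF assms])
  finally show ?thesis .
qed

lemma
  assumes "n \<le> 2 ^ m"
  shows integrable_exp_p0: "integrable (random_strings n)
      (\<lambda>\<omega>. exp (ln (3/2) / 2 * (real (p0 (\<omega> ` {..<n})) - real n * real m)))" (is "integrable _ ?Y")
    and integral_exp_p0_le: "(\<integral>\<omega>. exp (ln (3/2) / 2 * (real (p0 (\<omega> ` {..<n})) - real n * real m))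
      \<partial>random_strings n) \<le> 7 ^ n"
proof -
  have Y: "?Y \<in> borel_measurable (random_strings n)" by measurable
  have le: "(\<integral>\<^sup>+\<omega>. ennreal (?Y \<omega>) \<partial>random_strings n) \<le> ennreal (7 ^ n)"
    using nn_integral_exp_p0[OF assms] by (simp add: ennreal_power[symmetric])
  also have "\<dots> < \<infinity>" by simp
  finally show "integrable (random_strings n) ?Y"
    using Y by (intro integrableI_nonneg) auto
  show "(\<integral>\<omega>. ?Y \<omega> \<partial>random_strings n) \<le> 7 ^ n"
    using Y le by (subst integral_eq_nn_integral) (auto intro: enn2real_leI)
qed

text \<open>By \<open>x \<le> exp x\<close> the path length is dominated by an affine function of
  its exponential. Integrability ensures that \<open>expected_p0\<close> is a genuine mean and not
  the default value 0 of the integral.\<close>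

lemma integrable_p0: "integrable (random_strings n) (\<lambda>\<omega>. real (p0 (\<omega> ` {..<n})))"
proof -
  interpret prob_space "random_strings n" by (rule prob_space_random_strings)
  define Y where "Y \<omega> = exp (ln (3/2) / 2 * (real (p0 (\<omega> ` {..<n})) - real n * real n))" for \<omega>
  have "integrable (random_strings n) Y"
    unfolding Y_def by (intro integrable_exp_p0 less_imp_le less_exp)
  hence "integrable (random_strings n) (\<lambda>\<omega>. real n * real n + 2 / ln (3/2) * Y \<omega>)" by simp
  thus ?thesis
  proof (rule Bochner_Integration.integrable_bound)
    have "real (p0 (\<omega> ` {..<n})) \<le> real n * real n + 2 / ln (3/2) * Y \<omega>" for \<omega>
    proof -
      have "ln (3/2) / 2 * (real (p0 (\<omega> ` {..<n})) - real n * real n) \<le> Y \<omega>"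
        unfolding Y_def using exp_ge_add_one_self by (smt (verit))
      thus ?thesis by (simp add: field_simps)
    qed
    thus "AE \<omega> in random_strings n. norm (real (p0 (\<omega> ` {..<n}))) \<le> norm (real n * real n + 2 / ln (3/2) * Y \<omega>)"
      by (intro AE_I2) (smt (verit) of_nat_0_le_iff real_norm_def)
  qed measurable
qed

section \<open>Bounds on the mean\<close>

text \<open>Rounding the logarithm up costs at most one, the source of the 1 in the constants
  below.\<close>

lemma ex_power2_ge:
  assumes "n > 0"
  obtains m where "n \<le> 2 ^ m" "real m \<le> log 2 (real n) + 1"
proof
  have nonneg: "0 \<le> log 2 (real n)" using assms by simp
  have m: "log 2 (real n) \<le> real (nat \<lceil>log 2 (real n)\<rceil>)" by linarith
  have "real n = 2 powr log 2 (real n)" using assms by simp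
  also have "\<dots> \<le> 2 powr real (nat \<lceil>log 2 (real n)\<rceil>)" using m by simp
  also have "\<dots> = 2 ^ nat \<lceil>log 2 (real n)\<rceil>" by (simp add: powr_realpow)
  finally show "n \<le> 2 ^ nat \<lceil>log 2 (real n)\<rceil>"
    by (metis of_nat_le_iff of_nat_numeral of_nat_power)
  show "real (nat \<lceil>log 2 (real n)\<rceil>) \<le> log 2 (real n) + 1" using nonneg by linarith
qed

lemma expected_p0_lower:
  assumes "n > 0"
  shows "real n * log 2 (real n) \<le> expected_p0 n"
proof -
  interpret prob_space "random_strings n" by (rule prob_space_random_strings)
  have "AE \<omega> in random_strings n. real n * log 2 (real n) \<le> real (p0 (\<omega> ` {..<n}))"
    using AE_inj_on
  proof eventually_elim
    case (elim \<omega>)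
    show ?case
      \<comment> \<open>At \<open>k = 0\<close> the common prefix is empty and its string
        arbitrary.\<close>
      using p0_lower_bound[of "\<omega> ` {..<n}" n 0 undefined] elim assms by (simp add: card_image)
  qed
  thus ?thesis unfolding expected_p0_def
    using integrable_p0 by (intro integral_ge_const)
qed

text \<open>The moment bound \<open>7 ^ n\<close> at rate \<open>ln (3/2) / 2\<close> limits the
  mean excess over \<open>n * m\<close> to \<open>2 * n * ln 7 / ln (3/2)\<close>.\<close>

lemma expected_p0_upper:
  assumes "n > 0"
  shows "expected_p0 n \<le> real n * (log 2 (real n) + 1 + 2 * ln 7 / ln (3/2))"
proof -
  interpret prob_space "random_strings n" by (rule prob_space_random_strings)
  obtain m where m: "n \<le> 2 ^ m" "real m \<le> log 2 (real n) + 1"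
    using ex_power2_ge[OF assms] .
  define q where "q = ln (3/2::real)"
  have q: "q > 0" by (simp add: q_def)
  define Y where "Y \<omega> = exp (q / 2 * (real (p0 (\<omega> ` {..<n})) - real n * real m))" for \<omega>
  have Y: "integrable (random_strings n) Y" "expectation Y \<le> 7 ^ n"
    unfolding Y_def q_def by (rule integrable_exp_p0 integral_exp_p0_le; fact)+
  \<comment> \<open>Jensen's inequality, by the tangent of the exponential at \<open>ln (7 ^ n)\<close>\<close>
  have "real (p0 (\<omega> ` {..<n})) \<le> real n * real m + 2 / q * (real n * ln 7 + Y \<omega> / 7 ^ n - 1)" for \<omega>
  proof -
    define t where "t = q / 2 * (real (p0 (\<omega> ` {..<n})) - real n * real m)"
    have "1 + (t - real n * ln 7) \<le> exp (t - real n * ln 7)" by (rule exp_ge_add_one_self)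
    also have "\<dots> = Y \<omega> / 7 ^ n" by (simp add: Y_def t_def exp_diff exp_of_nat_mult)
    finally have "2 / q * t \<le> 2 / q * (real n * ln 7 + Y \<omega> / 7 ^ n - 1)"
      using q by (intro mult_left_mono) auto
    moreover have "2 / q * t = real (p0 (\<omega> ` {..<n})) - real n * real m"
      using q by (simp add: t_def)
    ultimately show ?thesis by linarith
  qed
  hence "expected_p0 n \<le> (\<integral>\<omega>. real n * real m + 2 / q * (real n * ln 7 + Y \<omega> / 7 ^ n - 1) \<partial>random_strings n)"
    unfolding expected_p0_def using Y integrable_p0 by (intro integral_mono) auto
  also have "\<dots> = real n * real m + 2 / q * (real n * ln 7 + expectation Y / 7 ^ n - 1)"
    using Y by (simp add: prob_space)
  also have "\<dots> \<le> real n * (log 2 (real n) + 1) + 2 / q * (real n * ln 7 + 1 - 1)"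
    using Y(2) m q by (intro add_mono mult_left_mono diff_right_mono) auto
  also have "\<dots> = real n * (log 2 (real n) + 1 + 2 * ln 7 / q)"
    by (simp add: algebra_simps)
  finally show ?thesis by (simp add: q_def)
qed

section \<open>Bounds on the tail\<close>

text \<open>The mean is at least \<open>n * log 2 n\<close>, hence at least
  \<open>n * (m - 1)\<close>. Exceeding it by \<open>c * n\<close> thus means exceeding
  \<open>n * m\<close> by \<open>(c - 1) * n\<close>, and Markov's inequality applies to the
  exponential.\<close>

lemma upper_tail_p0_le:
  assumes "n > 0"
  shows "measure (random_strings n) {\<omega> \<in> space (random_strings n).
      real (p0 (\<omega> ` {..<n})) \<ge> expected_p0 n + c * real n}
    \<le> exp (- (ln (3/2) / 2 * (c - 1) - ln 7) * real n)" (is "measure _ ?E \<le> _")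
proof -
  interpret prob_space "random_strings n" by (rule prob_space_random_strings)
  obtain m where m: "n \<le> 2 ^ m" "real m \<le> log 2 (real n) + 1"
    using ex_power2_ge[OF assms] .
  define q where "q = ln (3/2::real)"
  have q: "q > 0" by (simp add: q_def)
  define Y where "Y \<omega> = exp (q / 2 * (real (p0 (\<omega> ` {..<n})) - real n * real m))" for \<omega>
  have Y: "integrable (random_strings n) Y" "expectation Y \<le> 7 ^ n"
    unfolding Y_def q_def by (rule integrable_exp_p0 integral_exp_p0_le; fact)+
  define s where "s = exp (q / 2 * (c - 1) * real n)"
  have E: "?E \<in> events" by measurable
  have "s * indicator ?E \<omega> \<le> Y \<omega>" for \<omega>
  proof (cases "\<omega> \<in> ?E")
    case True
    have "real n * real m \<le> real n * (log 2 (real n) + 1)"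
      using m by (intro mult_left_mono) auto
    hence "(c - 1) * real n \<le> real (p0 (\<omega> ` {..<n})) - real n * real m"
      using True expected_p0_lower[OF assms] by (simp add: algebra_simps)
    hence "q / 2 * ((c - 1) * real n) \<le> q / 2 * (real (p0 (\<omega> ` {..<n})) - real n * real m)"
      using q by (intro mult_left_mono) auto
    thus ?thesis using True by (simp add: s_def Y_def mult.assoc)
  qed (simp add: Y_def)
  moreover have "integrable (random_strings n) (\<lambda>\<omega>. s * indicator ?E \<omega>)"
    using E by (intro integrable_mult_right integrable_real_indicator) (auto simp: emeasure_eq_measure)
  ultimately have "(\<integral>\<omega>. s * indicator ?E \<omega> \<partial>random_strings n) \<le> expectation Y"
    using Y by (intro integral_mono)
  hence "s * prob ?E \<le> 7 ^ n" using E Y(2) by simp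
  hence "prob ?E \<le> 7 ^ n / s" by (simp add: s_def field_simps)
  also have "(7::real) ^ n = exp (real n * ln 7)" by (simp add: exp_of_nat_mult)
  also have "\<dots> / s = exp (- (q / 2 * (c - 1) - ln 7) * real n)"
    unfolding s_def exp_diff[symmetric] by (simp add: algebra_simps)
  finally show ?thesis by (simp add: q_def)
qed

lemma measure_common_prefix:
  "measure (random_strings n) {\<omega> \<in> space (random_strings n). \<forall>i<n. stake k (\<omega> i) = stake k \<gamma>}
    = (1/2) ^ (k * n)"
proof -
  interpret product_prob_space "\<lambda>_::nat. random_string" "{..<n}"
    by (intro product_prob_spaceI prob_space_random_string)
  interpret finite_product_prob_space "\<lambda>_::nat. random_string" "{..<n}"
    by unfold_locales simp
  have "{\<omega> \<in> space (random_strings n). \<forall>i<n. stake k (\<omega> i) = stake k \<gamma>} =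
      (\<Pi>\<^sub>E i\<in>{..<n}. {x. stake k x = stake k \<gamma>})"
    unfolding random_strings_def space_PiM space_random_string set_eq_iff PiE_iff mem_Collect_eq by blast
  moreover have "prob (\<Pi>\<^sub>E i\<in>{..<n}. {x. stake k x = stake k \<gamma>}) = (1/2) ^ (k * n)"
    by (subst prob_times[OF cylinder_in_sets]) (simp only: measure_cylinder prod_constant card_lessThan power_mult)
  ultimately show ?thesis by (simp only: random_strings_def)
qed

text \<open>A common prefix of \<open>k\<close> bits lifts the path length to
  \<open>n * (log 2 n + k)\<close>. This \<open>k\<close> pays for both the possible gap between the
  mean and \<open>n * log 2 n\<close> and the deviation \<open>c * n\<close>.\<close>

lemma upper_tail_p0_ge:
  assumes n: "n \<ge> 2" and k: "real k \<ge> 1 + 2 * ln 7 / ln (3/2) + c"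
  shows "(1/2) ^ (k * n) \<le> measure (random_strings n) {\<omega> \<in> space (random_strings n).
      real (p0 (\<omega> ` {..<n})) \<ge> expected_p0 n + c * real n}"
proof -
  interpret prob_space "random_strings n" by (rule prob_space_random_strings)
  \<comment> \<open>Which prefix is shared is immaterial: all cylinders of one length are equally
    likely.\<close>
  fix \<gamma> :: "bool stream"
  have "AE \<omega> in random_strings n. (\<forall>i<n. stake k (\<omega> i) = stake k \<gamma>) \<longrightarrow>
      real (p0 (\<omega> ` {..<n})) \<ge> expected_p0 n + c * real n"
    using AE_inj_on
  proof (eventually_elim, intro impI)
    fix \<omega> :: "nat \<Rightarrow> bool stream"
    assume inj: "inj_on \<omega> {..<n}" and pre: "\<forall>i<n. stake k (\<omega> i) = stake k \<gamma>"
    have "expected_p0 n + c * real n \<le> real n * (log 2 (real n) + 1 + 2 * ln 7 / ln (3/2)) + c * real n"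
      using n by (intro add_right_mono expected_p0_upper) simp
    also have "\<dots> = real n * (log 2 (real n) + (1 + 2 * ln 7 / ln (3/2) + c))"
      by (simp add: algebra_simps)
    also have "\<dots> \<le> real n * (log 2 (real n) + real k)"
      using k by (intro mult_left_mono add_left_mono) auto
    also have "\<dots> \<le> real (p0 (\<omega> ` {..<n}))"
    proof (rule p0_lower_bound)
      show "card (\<omega> ` {..<n}) = n" using inj by (simp add: card_image)
      show "stake k \<alpha> = stake k \<gamma>" if "\<alpha> \<in> \<omega> ` {..<n}" for \<alpha> using that pre by blast
    qed (use n in simp_all)
    finally show "expected_p0 n + c * real n \<le> real (p0 (\<omega> ` {..<n}))" .
  qed
  hence "measure (random_strings n) {\<omega> \<in> space (random_strings n). \<forall>i<n. stake k (\<omega> i) = stake k \<gamma>}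
    \<le> measure (random_strings n) {\<omega> \<in> space (random_strings n).
      real (p0 (\<omega> ` {..<n})) \<ge> expected_p0 n + c * real n}"
  proof (intro finite_measure_mono_AE)
    assume "AE \<omega> in random_strings n. (\<forall>i<n. stake k (\<omega> i) = stake k \<gamma>) \<longrightarrow>
      real (p0 (\<omega> ` {..<n})) \<ge> expected_p0 n + c * real n"
    thus "AE \<omega> in random_strings n.
        \<omega> \<in> {\<omega> \<in> space (random_strings n). \<forall>i<n. stake k (\<omega> i) = stake k \<gamma>} \<longrightarrow>
        \<omega> \<in> {\<omega> \<in> space (random_strings n). real (p0 (\<omega> ` {..<n})) \<ge> expected_p0 n + c * real n}"
      by eventually_elim simp
  qed measurable
  thus ?thesis by (simp only: measure_common_prefix)
qed

section \<open>The linear growth order\<close>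

theorem theorem3:
  shows "\<exists>C::real. C > 0 \<and> (\<forall>c>C. (\<lambda>n::nat. R0 n (c * real n)) \<in> \<Theta>(\<lambda>n. real n))"
proof (intro exI conjI allI impI)
  \<comment> \<open>The zero of the exponent \<open>a\<close> of the upper tail bound as a function
    of \<open>c\<close>; also the constant in \<open>expected_p0_upper\<close>.\<close>
  define C where "C = 1 + 2 * ln 7 / ln (3/2::real)"
  show "C > 0" by (simp add: C_def add_pos_pos)
  fix c assume "c > C"
  define a where "a = ln (3/2) / 2 * (c - 1) - ln 7"
  define k where "k = nat \<lceil>C + c\<rceil>"
  have "a = ln (3/2) / 2 * (c - C)" by (simp add: a_def C_def field_simps)
  moreover have "ln (3/2) / 2 * (c - C) > 0" using \<open>c > C\<close> by (intro mult_pos_pos) auto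
  ultimately have a: "a > 0" by simp
  have k: "real k \<ge> C + c" unfolding k_def by linarith
  have "k > 0" using \<open>C > 0\<close> \<open>c > C\<close> by (simp add: k_def)
  show "(\<lambda>n::nat. R0 n (c * real n)) \<in> \<Theta>(\<lambda>n. real n)"
  proof (rule bigthetaI')
    show "a > 0" "real k * ln 2 > 0" using a \<open>k > 0\<close> by auto
    show "\<forall>\<^sub>F n in at_top. a * norm (real n) \<le> norm (R0 n (c * real n)) \<and>
        norm (R0 n (c * real n)) \<le> real k * ln 2 * norm (real n)"
      using eventually_ge_at_top[of 2]
    proof eventually_elim
      case (elim n)
      define p where "p = measure (random_strings n) {\<omega> \<in> space (random_strings n).
        real (p0 (\<omega> ` {..<n})) \<ge> expected_p0 n + c * real n}"
      have le: "p \<le> exp (- a * real n)"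
        unfolding p_def a_def using elim by (intro upper_tail_p0_le) simp
      have ge: "(1/2) ^ (k * n) \<le> p"
        unfolding p_def using elim k by (intro upper_tail_p0_ge) (simp_all add: C_def)
      \<comment> \<open>Positivity of \<open>p\<close> excludes the default \<open>ln 0 = 0\<close>
        and permits monotonicity of the logarithm.\<close>
      have "0 < (1/2::real) ^ (k * n)" by simp
      with ge have pos: "p > 0" by linarith
      have "ln p \<le> - a * real n" using le pos by (metis ln_exp ln_le_cancel_iff exp_gt_zero)
      moreover have "ln ((1/2) ^ (k * n)) \<le> ln p" using ge pos by simp
      hence "- (real k * ln 2 * real n) \<le> ln p" by (simp add: ln_realpow ln_div mult_ac)
      moreover have "R0 n (c * real n) = - ln p" by (simp add: R0_def p_def)
      moreover have "0 \<le> a * real n" using a by simp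
      ultimately show ?case by simp
    qed
  qed
qed

end
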